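(* Let $\Gamma$ be a CNF and let $C=\{p\}\cup C'$ (with the variable of the literal $p$ not occurring in $C'$) be a clause with $\mathrm{var}(C)\subseteq\mathrm{var}(\Gamma)$ that is a RAT for $p$ with respect to $\Gamma$. Let $\Sigma=\mathrm{NB}^\Gamma_p(C)$ and $n=|\mathrm{var}(\Gamma)|$. Then there exists a $\mathsf{BC}^-$ derivation $(\Gamma_1,\dots,\Gamma_N)$ such that $\Gamma_1=\Gamma$, $C\in\Gamma_N$, every clause of $\Gamma_N$ contains (as a subset) some clause of $\Gamma\cup\{C\}$, and $$N\leq |\Sigma|\,(n+1)+s(\Sigma).$$
   Context: A literal is a propositional variable or its negation; $\overline{p}$ is the complement of $p$. A set of literals is tautological if it contains some $x$ and $\overline{x}$. A clause is a finite nontautological set of literals (read as a disjunction); $\bot$ is the empty clause. A CNF is a finite set of clauses; $\mathrm{var}(\cdot)$ denotes the set of variables occurring in a clause or CNF. Resolution. If $A\cup\{x\}$ and $B\cup\{\overline{x}\}$ are clauses with $x$ a variable not occurring in $A$ or $B$, and $A\cup B$ is a clause, then $A\cup B$ is their resolvent on $x$. A weakening of a clause $A$ is any clause $A\cup B$. A resolution proof of $\Gamma$ is a sequence $(\Gamma_1,\dots,\Gamma_N)$ of CNFs with $\Gamma_1=\Gamma$, $\bot\in\Gamma_N$, and each $\Gamma_{i+1}=\Gamma_i\cup\{C\}$, where $C$ is a resolvent of two clauses of $\Gamma_i$ or a weakening of a clause of $\Gamma_i$; its size is $N$. $\mathrm{size}_{\mathsf{Res}}(\Gamma)$ is the minimum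 size of a resolution proof of $\Gamma$ ($\infty$ if $\Gamma$ is satisfiable). Unit propagation. A unit propagation proof is a resolution proof in which, in each use of the resolution rule, one of the two premises is a clause with a single literal. For a set $L$ of literals, $\Gamma\vdash_1 L$ means that $\Gamma\cup\{\{\overline{q}\} : q\in L\}$ has a unit propagation proof. BC and RAT. A clause $C=\{p\}\cup C'$ (variable of $p$ not in $C'$) is blocked (a BC), respectively a RAT, for $p$ with respect to $\Gamma$ if for every $D\in\Gamma$ of the form $\{\overline{p}\}\cup D'$ (variable of $p$ not in $D'$) the set $C'\cup D'$ is tautological, respectively $\Gamma\vdash_1 C'\cup D'$. $C$ is a BC with respect to $\Gamma$ if it is one for some $p\in C$. A $\mathsf{BC}^-$ derivation from $\Gamma$ is a sequence $(\Gamma_1,\dots,\Gamma_N)$ of CNFs with $\Gamma_1=\Gamma$ in which only variables of $\mathrm{var}(\Gamma)$ occur and each $\Gamma_{i+1}=\Gamma_i\cup\{E\}$, where $E$ is a resolvent of two clauses of $\Gamma_i$, a weakening of a clause of $\Gamma_i$, or a blocked clause with respect to $\Gamma_i$. Nonblocking CNF. For a literal $q$, $\mathrm{proj}_q(\Gamma)=\{D\setminus\{q\} : D\in\Gamma,\ q\in D\}$. For a clause $C$ and $p\in C$, $$\mathrm{NB}^\Gamma_p(C)=\{D\setminus C : D\in\mathrm{proj}_{\overline{p}}(\Gamma)\text{ and }(C\setminus\{p\})\cup D\text{ is nontautological}\}.$$ The function $s$. A partial assignment is identified with the (nontautological) set of literals it makes true; it satisfies a CNF if it intersects every clause of it. A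 partial assignment $\alpha$ minimally satisfies $\Sigma$ if it satisfies $\Sigma$ and no proper subset of $\alpha$ does. Let $\mu(\Sigma)$ be the set of clauses $E$ such that $\overline{E}=\{\overline{q} : q\in E\}$ minimally satisfies $\Sigma$ (the CNF $\Sigma\cup\mu(\Sigma)$ is always unsatisfiable), and let $$s(\Sigma)=|\mu(\Sigma)|+\mathrm{size}_{\mathsf{Res}}(\Sigma\cup\mu(\Sigma)).$$ *)

theory Defs
  imports Main "HOL-Library.Extended_Nat"
begin

datatype 'v literal = Pos (var_lit: 'v) | Neg (var_lit: 'v)

fun comp_lit :: "'v literal \<Rightarrow> 'v literal" where
  "comp_lit (Pos x) = Neg x"
| "comp_lit (Neg x) = Pos x"

definition tautological :: "'v literal set \<Rightarrow> bool" where
  "tautological L \<longleftrightarrow> (\<exists>x. Pos x \<in> L \<and> Neg x \<in> L)"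

type_synonym 'v clause = "'v literal set"
type_synonym 'v cnf = "'v clause set"

definition is_clause :: "'v clause \<Rightarrow> bool" where
  "is_clause C \<longleftrightarrow> finite C \<and> \<not> tautological C"

definition is_cnf :: "'v cnf \<Rightarrow> bool" where
  "is_cnf \<Gamma> \<longleftrightarrow> finite \<Gamma> \<and> (\<forall>C\<in>\<Gamma>. is_clause C)"

definition vars_clause :: "'v literal set \<Rightarrow> 'v set" where
  "vars_clause C = var_lit ` C"

definition vars_cnf :: "'v cnf \<Rightarrow> 'v set" where
  "vars_cnf \<Gamma> = (\<Union>C\<in>\<Gamma>. vars_clause C)"

definition resolvent :: "'v clause \<Rightarrow> 'v clause \<Rightarrow> 'v clause \<Rightarrow> bool" where
  "resolvent F G E \<longleftrightarrow> is_clause F \<and> is_clause G \<and> is_clause E \<and>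
     (\<exists>x A B. F = A \<union> {Pos x} \<and> G = B \<union> {Neg x} \<and>
        x \<notin> vars_clause A \<and> x \<notin> vars_clause B \<and> E = A \<union> B)"

definition weakening :: "'v clause \<Rightarrow> 'v clause \<Rightarrow> bool" where
  "weakening A E \<longleftrightarrow> is_clause E \<and> (\<exists>B. E = A \<union> B)"

definition res_step :: "'v cnf \<Rightarrow> 'v clause \<Rightarrow> bool" where
  "res_step \<Gamma> E \<longleftrightarrow> (\<exists>F\<in>\<Gamma>. \<exists>G\<in>\<Gamma>. resolvent F G E) \<or> (\<exists>A\<in>\<Gamma>. weakening A E)"

definition unit_step :: "'v cnf \<Rightarrow> 'v clause \<Rightarrow> bool" where
  "unit_step \<Gamma> E \<longleftrightarrow>
     (\<exists>F\<in>\<Gamma>. \<exists>G\<in>\<Gamma>. resolvent F G E \<and> (card F = 1 \<or> card G = 1)) \<or> (\<exists>A\<in>\<Gamma>. weakening A E)"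

text \<open>The size of a derivation is the length of the list, so the initial CNF counts.
  A step may add a clause that is already present.\<close>

definition derivation ::
  "('v cnf \<Rightarrow> 'v clause \<Rightarrow> bool) \<Rightarrow> 'v cnf \<Rightarrow> 'v cnf list \<Rightarrow> bool" where
  "derivation step \<Gamma> \<Gamma>s \<longleftrightarrow> \<Gamma>s \<noteq> [] \<and> hd \<Gamma>s = \<Gamma> \<and> (\<forall>\<Delta>\<in>set \<Gamma>s. is_cnf \<Delta>) \<and>
     (\<forall>i. Suc i < length \<Gamma>s \<longrightarrow> (\<exists>E. step (\<Gamma>s ! i) E \<and> \<Gamma>s ! Suc i = \<Gamma>s ! i \<union> {E}))"

definition resolution_proof :: "'v cnf \<Rightarrow> 'v cnf list \<Rightarrow> bool" where
  "resolution_proof \<Gamma> \<Gamma>s \<longleftrightarrow> derivation res_step \<Gamma> \<Gamma>s \<and> {} \<in> last \<Gamma>s"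

definition unit_propagation_proof :: "'v cnf \<Rightarrow> 'v cnf list \<Rightarrow> bool" where
  "unit_propagation_proof \<Gamma> \<Gamma>s \<longleftrightarrow> derivation unit_step \<Gamma> \<Gamma>s \<and> {} \<in> last \<Gamma>s"

text \<open>The infimum of the empty set is \<open>\<infinity>\<close>, which covers satisfiable CNFs.\<close>

definition size_Res :: "'v cnf \<Rightarrow> enat" where
  "size_Res \<Gamma> = (INF \<Gamma>s \<in> {\<Gamma>s. resolution_proof \<Gamma> \<Gamma>s}. enat (length \<Gamma>s))"

definition up_implies :: "'v cnf \<Rightarrow> 'v literal set \<Rightarrow> bool" (infix "\<turnstile>\<^sub>1" 50) where
  "\<Gamma> \<turnstile>\<^sub>1 L \<longleftrightarrow> (\<exists>\<Gamma>s. unit_propagation_proof (\<Gamma> \<union> {{comp_lit q} | q. q \<in> L}) \<Gamma>s)"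

definition blocked_for :: "'v cnf \<Rightarrow> 'v literal \<Rightarrow> 'v clause \<Rightarrow> bool" where
  "blocked_for \<Gamma> p C \<longleftrightarrow> is_clause C \<and>
     (\<exists>C'. C = {p} \<union> C' \<and> var_lit p \<notin> vars_clause C' \<and>
        (\<forall>D'. {comp_lit p} \<union> D' \<in> \<Gamma> \<and> var_lit p \<notin> vars_clause D' \<longrightarrow> tautological (C' \<union> D')))"

definition rat_for :: "'v cnf \<Rightarrow> 'v literal \<Rightarrow> 'v clause \<Rightarrow> bool" where
  "rat_for \<Gamma> p C \<longleftrightarrow> is_clause C \<and>
     (\<exists>C'. C = {p} \<union> C' \<and> var_lit p \<notin> vars_clause C' \<and>
        (\<forall>D'. {comp_lit p} \<union> D' \<in> \<Gamma> \<and> var_lit p \<notin> vars_clause D' \<longrightarrow> \<Gamma> \<turnstile>\<^sub>1 C' \<union> D'))"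

definition blocked :: "'v cnf \<Rightarrow> 'v clause \<Rightarrow> bool" where
  "blocked \<Gamma> C \<longleftrightarrow> (\<exists>p\<in>C. blocked_for \<Gamma> p C)"

definition BC_minus_derivation :: "'v cnf \<Rightarrow> 'v cnf list \<Rightarrow> bool" where
  "BC_minus_derivation \<Gamma> \<Gamma>s \<longleftrightarrow>
     derivation (\<lambda>\<Delta> E. res_step \<Delta> E \<or> blocked \<Delta> E) \<Gamma> \<Gamma>s \<and>
     (\<forall>\<Delta>\<in>set \<Gamma>s. vars_cnf \<Delta> \<subseteq> vars_cnf \<Gamma>)"

definition proj :: "'v literal \<Rightarrow> 'v cnf \<Rightarrow> 'v cnf" where
  "proj q \<Gamma> = {D - {q} | D. D \<in> \<Gamma> \<and> q \<in> D}"

definition NB :: "'v cnf \<Rightarrow> 'v literal \<Rightarrow> 'v clause \<Rightarrow> 'v cnf" where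
  "NB \<Gamma> p C = {D - C | D. D \<in> proj (comp_lit p) \<Gamma> \<and> \<not> tautological ((C - {p}) \<union> D)}"

definition partial_assignment :: "'v literal set \<Rightarrow> bool" where
  "partial_assignment \<alpha> \<longleftrightarrow> \<not> tautological \<alpha>"

definition satisfies :: "'v literal set \<Rightarrow> 'v cnf \<Rightarrow> bool" where
  "satisfies \<alpha> \<Sigma> \<longleftrightarrow> (\<forall>D\<in>\<Sigma>. \<alpha> \<inter> D \<noteq> {})"

definition minimally_satisfies :: "'v literal set \<Rightarrow> 'v cnf \<Rightarrow> bool" where
  "minimally_satisfies \<alpha> \<Sigma> \<longleftrightarrow> partial_assignment \<alpha> \<and> satisfies \<alpha> \<Sigma> \<and>
     (\<forall>\<beta>. \<beta> \<subset> \<alpha> \<longrightarrow> \<not> satisfies \<beta> \<Sigma>)"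

definition mu :: "'v cnf \<Rightarrow> 'v cnf" where
  "mu \<Sigma> = {E. is_clause E \<and> minimally_satisfies (comp_lit ` E) \<Sigma>}"

definition s_fun :: "'v cnf \<Rightarrow> enat" where
  "s_fun \<Sigma> = enat (card (mu \<Sigma>)) + size_Res (\<Sigma> \<union> mu \<Sigma>)"

end

theory Submission
  imports Defs
begin

text \<open>All clauses added to \<open>\<Gamma>\<close> contain \<open>C\<close>, hence contain \<open>p\<close> and cannot obstruct blockedness
  for \<open>p\<close>. First, for \<open>F \<in> \<Sigma>\<close>, the clause \<open>C \<union> F\<close> is obtained by turning the unit propagation
  refutation into a trail of implied literals and resolving a falsified clause, weakened by
  \<open>C \<union> F\<close>, backwards along the trail; this costs at most \<open>n + 1\<close> steps. Next, for \<open>E \<in> \<mu>(\<Sigma>)\<close>,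
  the clause \<open>C \<union> E\<close> is blocked for \<open>p\<close>, because the negation of \<open>E\<close> hits every clause of
  \<open>\<Sigma>\<close>. Finally, a shortest refutation of \<open>\<Sigma> \<union> \<mu>(\<Sigma>)\<close>, restricted to the variables of
  \<open>\<Sigma>\<close> and with \<open>C\<close> added to each clause, ends in \<open>C\<close>.\<close>

section \<open>Literals and clauses\<close>

lemma comp_comp [simp]: "comp_lit (comp_lit l) = l"
  by (cases l) auto

lemma var_comp [simp]: "var_lit (comp_lit l) = var_lit l"
  by (cases l) auto

lemma comp_neq [simp]: "comp_lit l \<noteq> l" "l \<noteq> comp_lit l"
  by (cases l; simp)+

lemma comp_eq_iff [simp]: "comp_lit a = comp_lit b \<longleftrightarrow> a = b"
  by (metis comp_comp)

lemma comp_image_comp [simp]: "comp_lit ` comp_lit ` L = L"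
  by (simp add: image_image)

lemma same_var_iff: "var_lit a = var_lit b \<longleftrightarrow> a = b \<or> a = comp_lit b"
  by (cases a; cases b) auto

lemma tautological_iff: "tautological L \<longleftrightarrow> (\<exists>l\<in>L. comp_lit l \<in> L)"
proof
  assume "\<exists>l\<in>L. comp_lit l \<in> L"
  then obtain l where "l \<in> L" "comp_lit l \<in> L" by blast
  then show "tautological L" by (cases l) (auto simp: tautological_def)
qed (force simp: tautological_def)

lemma tautological_mono: "tautological A \<Longrightarrow> A \<subseteq> B \<Longrightarrow> tautological B"
  by (auto simp: tautological_def)

lemma is_clause_mono: "is_clause B \<Longrightarrow> A \<subseteq> B \<Longrightarrow> is_clause A"
  using finite_subset tautological_mono unfolding is_clause_def by blast

lemma in_vars_clause_iff: "var_lit l \<in> vars_clause L \<longleftrightarrow> l \<in> L \<or> comp_lit l \<in> L"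
proof -
  have "l = x \<or> l = comp_lit x \<longleftrightarrow> x = l \<or> x = comp_lit l" for x by auto
  then show ?thesis by (auto simp: vars_clause_def image_iff same_var_iff)
qed

lemma is_clause_Un_disjoint:
  assumes "is_clause A" "is_clause B" "vars_clause A \<inter> vars_clause B = {}"
  shows "is_clause (A \<union> B)"
  using assms unfolding is_clause_def tautological_iff
  by (auto simp: vars_clause_def) (metis IntI empty_iff imageI var_comp)+

lemma is_clause_insert:
  "is_clause (insert l L) \<longleftrightarrow> is_clause L \<and> comp_lit l \<notin> L"
  unfolding is_clause_def tautological_iff by auto

lemma vars_clause_Un [simp]: "vars_clause (A \<union> B) = vars_clause A \<union> vars_clause B"
  by (auto simp: vars_clause_def)

lemma vars_clause_mono: "A \<subseteq> B \<Longrightarrow> vars_clause A \<subseteq> vars_clause B"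
  by (auto simp: vars_clause_def)

lemma vars_cnf_member: "A \<in> \<Delta> \<Longrightarrow> vars_clause A \<subseteq> vars_cnf \<Delta>"
  by (auto simp: vars_cnf_def)

lemma vars_clause_restrict: "vars_clause {l \<in> A. var_lit l \<in> V} \<subseteq> V"
  by (auto simp: vars_clause_def)

lemma is_clause_Un_restrict:
  assumes "is_clause A" "is_clause C" "V \<inter> vars_clause C = {}"
  shows "is_clause (C \<union> {l \<in> A. var_lit l \<in> V})"
proof (rule is_clause_Un_disjoint[OF assms(2)])
  show "is_clause {l \<in> A. var_lit l \<in> V}" by (rule is_clause_mono[OF assms(1)]) blast
  show "vars_clause C \<inter> vars_clause {l \<in> A. var_lit l \<in> V} = {}"
    using assms(3) vars_clause_restrict[of A V] by (simp add: disjoint_iff subset_iff) blast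
qed

lemma finite_vars_cnf: "is_cnf \<Delta> \<Longrightarrow> finite (vars_cnf \<Delta>)"
  by (auto simp: is_cnf_def is_clause_def vars_cnf_def vars_clause_def)

lemma finite_lits_with_vars: "finite V \<Longrightarrow> finite {l. var_lit l \<in> V}"
proof -
  assume "finite V"
  have "l \<in> Pos ` V \<union> Neg ` V" if "var_lit l \<in> V" for l using that by (cases l) auto
  then have "{l. var_lit l \<in> V} \<subseteq> Pos ` V \<union> Neg ` V" by blast
  with \<open>finite V\<close> show ?thesis by (meson finite_UnI finite_imageI finite_subset)
qed

section \<open>Derivations as lists of clauses\<close>

text \<open>Listing only the added clauses makes induction and concatenation direct. The growing
  CNFs are recovered by \<open>cnf_seq\<close>.\<close>

fun clause_seq :: "('v cnf \<Rightarrow> 'v clause \<Rightarrow> bool) \<Rightarrow> 'v cnf \<Rightarrow> 'v clause list \<Rightarrow> bool" where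
  "clause_seq step \<Delta> [] \<longleftrightarrow> True"
| "clause_seq step \<Delta> (E # Es) \<longleftrightarrow> step \<Delta> E \<and> clause_seq step (insert E \<Delta>) Es"

fun cnf_seq :: "'v cnf \<Rightarrow> 'v clause list \<Rightarrow> 'v cnf list" where
  "cnf_seq \<Delta> [] = [\<Delta>]"
| "cnf_seq \<Delta> (E # Es) = \<Delta> # cnf_seq (insert E \<Delta>) Es"

lemma clause_seq_append:
  "clause_seq step \<Delta> (xs @ ys) \<longleftrightarrow> clause_seq step \<Delta> xs \<and> clause_seq step (\<Delta> \<union> set xs) ys"
  by (induction xs arbitrary: \<Delta>) auto

lemma cnf_seq_neq_Nil [simp]: "cnf_seq \<Delta> Es \<noteq> []"
  by (cases Es) auto

lemma last_cnf_seq: "last (cnf_seq \<Delta> Es) = \<Delta> \<union> set Es"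
  by (induction Es arbitrary: \<Delta>) auto

text \<open>The extra entry is the initial CNF, which counts towards the size.\<close>

lemma length_cnf_seq: "length (cnf_seq \<Delta> Es) = Suc (length Es)"
  by (induction Es arbitrary: \<Delta>) auto

lemma cnf_seq_bounds: "\<Delta>' \<in> set (cnf_seq \<Delta> Es) \<Longrightarrow> \<Delta>' \<subseteq> \<Delta> \<union> set Es"
  by (induction Es arbitrary: \<Delta>) auto

lemma derivation_singleton: "derivation step \<Gamma> [\<Delta>] \<longleftrightarrow> \<Delta> = \<Gamma> \<and> is_cnf \<Gamma>"
  by (auto simp: derivation_def)

lemma derivation_Cons:
  assumes "\<Delta>s \<noteq> []"
  shows "derivation step \<Gamma> (\<Delta> # \<Delta>s) \<longleftrightarrow>
    \<Delta> = \<Gamma> \<and> is_cnf \<Gamma> \<and> (\<exists>E. step \<Gamma> E \<and> derivation step (insert E \<Gamma>) \<Delta>s)"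
    (is "?L \<longleftrightarrow> ?R")
proof
  assume L: ?L
  then have eq: "\<Delta> = \<Gamma>" and cnf: "is_cnf \<Gamma>" and cnfs: "\<forall>\<Delta>'\<in>set \<Delta>s. is_cnf \<Delta>'"
    by (auto simp: derivation_def)
  have steps: "\<exists>E. step ((\<Delta> # \<Delta>s) ! i) E \<and> (\<Delta> # \<Delta>s) ! Suc i = (\<Delta> # \<Delta>s) ! i \<union> {E}"
    if "Suc i < length (\<Delta> # \<Delta>s)" for i
    using L that unfolding derivation_def by blast
  from steps[of 0] assms eq obtain E where E: "step \<Gamma> E" "\<Delta>s ! 0 = insert E \<Gamma>" by auto
  have "derivation step (insert E \<Gamma>) \<Delta>s"
    unfolding derivation_def using assms E(2) cnfs steps[of "Suc i" for i]
    by (auto simp: hd_conv_nth)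
  with eq cnf E(1) show ?R by blast
next
  assume ?R
  then obtain E where R: "\<Delta> = \<Gamma>" "is_cnf \<Gamma>" "step \<Gamma> E" "derivation step (insert E \<Gamma>) \<Delta>s"
    by blast
  show ?L unfolding derivation_def
  proof (intro conjI allI impI)
    fix i assume i: "Suc i < length (\<Delta> # \<Delta>s)"
    show "\<exists>E. step ((\<Delta> # \<Delta>s) ! i) E \<and> (\<Delta> # \<Delta>s) ! Suc i = (\<Delta> # \<Delta>s) ! i \<union> {E}"
    proof (cases i)
      case 0
      then show ?thesis using R assms by (auto simp: derivation_def hd_conv_nth intro!: exI[of _ E])
    next
      case (Suc j)
      then show ?thesis using R(4) i by (auto simp: derivation_def)
    qed
  qed (use R in \<open>auto simp: derivation_def\<close>)
qed

lemma derivation_cnf_seq: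
  assumes "is_cnf \<Delta>" "clause_seq step \<Delta> Es" "\<And>E. E \<in> set Es \<Longrightarrow> is_clause E"
  shows "derivation step \<Delta> (cnf_seq \<Delta> Es)"
  using assms
proof (induction Es arbitrary: \<Delta>)
  case Nil
  then show ?case by (simp add: derivation_singleton)
next
  case (Cons E Es)
  have "is_cnf (insert E \<Delta>)" using Cons.prems by (auto simp: is_cnf_def)
  then show ?case using Cons by (auto simp: derivation_Cons)
qed

lemma derivation_clause_seq:
  assumes "derivation step \<Delta> \<Gamma>s"
  shows "\<exists>Es. clause_seq step \<Delta> Es \<and> length \<Gamma>s = Suc (length Es) \<and> last \<Gamma>s = \<Delta> \<union> set Es"
  using assms
proof (induction \<Gamma>s arbitrary: \<Delta>)
  case Nil
  then show ?case by (simp add: derivation_def)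
next
  case (Cons \<Delta>' \<Gamma>s)
  show ?case
  proof (cases "\<Gamma>s = []")
    case True
    then show ?thesis using Cons.prems by (auto simp: derivation_singleton intro!: exI[of _ "[]"])
  next
    case False
    with Cons.prems obtain E where E: "step \<Delta> E" "derivation step (insert E \<Delta>) \<Gamma>s"
      by (auto simp: derivation_Cons)
    from Cons.IH[OF E(2)] obtain Es where
      "clause_seq step (insert E \<Delta>) Es" "length \<Gamma>s = Suc (length Es)"
      "last \<Gamma>s = insert E \<Delta> \<union> set Es" by blast
    with E(1) False show ?thesis by (intro exI[of _ "E # Es"]) auto
  qed
qed

section \<open>Resolution\<close>

lemma res_step_is_clause: "res_step \<Delta> E \<Longrightarrow> is_clause E"
  by (auto simp: res_step_def resolvent_def weakening_def)

lemma res_step_mono: "res_step \<Delta> E \<Longrightarrow> \<Delta> \<subseteq> \<Delta>' \<Longrightarrow> res_step \<Delta>' E"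
  unfolding res_step_def by blast

lemma res_step_weaken: "A \<in> \<Delta> \<Longrightarrow> A \<subseteq> E \<Longrightarrow> is_clause E \<Longrightarrow> res_step \<Delta> E"
  unfolding res_step_def weakening_def by blast

lemma res_step_resolve:
  assumes "insert l A \<in> \<Delta>" "insert (comp_lit l) B \<in> \<Delta>"
    and "is_clause (insert l A)" "is_clause (insert (comp_lit l) B)" "is_clause (A \<union> B)"
    and "var_lit l \<notin> vars_clause A" "var_lit l \<notin> vars_clause B"
  shows "res_step \<Delta> (A \<union> B)"
proof (cases l)
  case (Pos x)
  then have "resolvent (insert l A) (insert (comp_lit l) B) (A \<union> B)"
    using assms unfolding resolvent_def
    by (intro conjI exI[of _ x] exI[of _ A] exI[of _ B]) (auto simp: Un_commute)
  with assms show ?thesis unfolding res_step_def by blast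
next
  case (Neg x)
  then have "resolvent (insert (comp_lit l) B) (insert l A) (A \<union> B)"
    using assms unfolding resolvent_def
    by (intro conjI exI[of _ x] exI[of _ B] exI[of _ A]) (auto simp: Un_commute)
  with assms show ?thesis unfolding res_step_def by blast
qed

lemma clause_seq_mono:
  "clause_seq res_step \<Delta> Es \<Longrightarrow> \<Delta> \<subseteq> \<Delta>' \<Longrightarrow> clause_seq res_step \<Delta>' Es"
proof (induction Es arbitrary: \<Delta> \<Delta>')
  case (Cons E Es)
  then show ?case using Cons.IH[of "insert E \<Delta>" "insert E \<Delta>'"] by (auto intro: res_step_mono)
qed simp

lemma clause_seq_is_clause: "clause_seq res_step \<Delta> Es \<Longrightarrow> E \<in> set Es \<Longrightarrow> is_clause E"
  by (induction Es arbitrary: \<Delta>) (auto dest: res_step_is_clause)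

lemma clause_seq_impl:
  assumes "clause_seq step \<Delta> Es" "\<And>\<Delta> E. step \<Delta> E \<Longrightarrow> step' \<Delta> E"
  shows "clause_seq step' \<Delta> Es"
  using assms(1) by (induction Es arbitrary: \<Delta>) (auto intro: assms(2))

text \<open>Length is ignored here, since this notion serves only to show that some refutation
  exists.\<close>

definition derivable :: "'v cnf \<Rightarrow> 'v clause \<Rightarrow> bool" where
  "derivable \<Delta> E \<longleftrightarrow> (\<exists>Es. clause_seq res_step \<Delta> Es \<and> E \<in> \<Delta> \<union> set Es)"

lemma derivable_weaken:
  assumes "A \<in> \<Delta>" "A \<subseteq> E" "is_clause E"
  shows "derivable \<Delta> E"
  unfolding derivable_def using res_step_weaken[OF assms] by (intro exI[of _ "[E]"]) auto

lemma derivable_resolve: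
  assumes "derivable \<Delta> (insert l E)" "derivable \<Delta> (insert (comp_lit l) E)"
    and "is_clause E" "var_lit l \<notin> vars_clause E"
  shows "derivable \<Delta> E"
proof -
  obtain Es1 Es2 where Es: "clause_seq res_step \<Delta> Es1" "insert l E \<in> \<Delta> \<union> set Es1"
      "clause_seq res_step \<Delta> Es2" "insert (comp_lit l) E \<in> \<Delta> \<union> set Es2"
    using assms(1,2) unfolding derivable_def by blast
  have cl: "is_clause (insert l E)" "is_clause (insert (comp_lit l) E)"
    using assms(3,4) by (auto simp: is_clause_insert in_vars_clause_iff)
  have "res_step (\<Delta> \<union> set (Es1 @ Es2)) (E \<union> E)"
    by (rule res_step_resolve[of l]) (use Es assms(3,4) cl in auto)
  moreover have "clause_seq res_step \<Delta> (Es1 @ Es2)"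
    using Es clause_seq_mono[OF Es(3)] by (auto simp: clause_seq_append)
  ultimately have "clause_seq res_step \<Delta> ((Es1 @ Es2) @ [E])"
    unfolding clause_seq_append[of _ _ "Es1 @ Es2"] by simp
  then show ?thesis unfolding derivable_def by (intro exI[of _ "(Es1 @ Es2) @ [E]"]) auto
qed

text \<open>Completeness by a full decision tree: a clause that lacks a variable of \<open>V\<close>
  is the resolvent of its two extensions by that variable, and each extension lacks fewer
  variables.\<close>

lemma derivable_from_total_clauses:
  assumes "finite V"
    and total: "\<And>E. is_clause E \<Longrightarrow> vars_clause E = V \<Longrightarrow> derivable \<Delta> E"
    and "is_clause E" "vars_clause E \<subseteq> V"
  shows "derivable \<Delta> E"
  using assms(3,4)
proof (induction "card (V - vars_clause E)" arbitrary: E rule: less_induct)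
  case less
  show ?case
  proof (cases "vars_clause E = V")
    case True
    with total less.prems show ?thesis by blast
  next
    case False
    then obtain x where x: "x \<in> V" "x \<notin> vars_clause E" using less.prems by blast
    have "derivable \<Delta> (insert l E)" if l: "var_lit l = x" for l
    proof (rule less.hyps)
      show "is_clause (insert l E)"
        using less.prems(1) x(2) l by (auto simp: is_clause_insert in_vars_clause_iff)
      show sub: "vars_clause (insert l E) \<subseteq> V"
        using less.prems(2) x(1) l by (auto simp: vars_clause_def)
      have "V - vars_clause (insert l E) \<subset> V - vars_clause E"
        using x l by (auto simp: vars_clause_def)
      then show "card (V - vars_clause (insert l E)) < card (V - vars_clause E)"
        using \<open>finite V\<close> by (meson finite_Diff psubset_card_mono)
    qed
    from derivable_resolve[OF this[of "Pos x"] this[of "comp_lit (Pos x)"]] less.prems x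
    show ?thesis by simp
  qed
qed

section \<open>The CNF \<open>\<Sigma> \<union> \<mu>(\<Sigma>)\<close>\<close>

text \<open>Otherwise \<open>comp_lit q\<close> would hit no clause, and dropping it from the
  assignment would contradict minimality. This confines the variables of \<open>mu \<Sigma>\<close>
  to those of \<open>\<Sigma>\<close>.\<close>

lemma mu_member_literal:
  assumes "E \<in> mu \<Sigma>" "q \<in> E"
  shows "\<exists>D\<in>\<Sigma>. comp_lit q \<in> D"
proof (rule ccontr)
  assume neg: "\<not> ?thesis"
  let ?\<beta> = "comp_lit ` E - {comp_lit q}"
  have min: "satisfies (comp_lit ` E) \<Sigma>" "\<And>\<beta>. \<beta> \<subset> comp_lit ` E \<Longrightarrow> \<not> satisfies \<beta> \<Sigma>"
    using assms(1) by (auto simp: mu_def minimally_satisfies_def)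
  have "satisfies ?\<beta> \<Sigma>" unfolding satisfies_def
  proof
    fix D assume D: "D \<in> \<Sigma>"
    with min(1) obtain d where d: "d \<in> comp_lit ` E" "d \<in> D"
      unfolding satisfies_def by (meson disjoint_iff)
    with neg D have "d \<noteq> comp_lit q" by blast
    with d have "d \<in> ?\<beta> \<inter> D" by simp
    then show "?\<beta> \<inter> D \<noteq> {}" by (metis empty_iff)
  qed
  moreover have "?\<beta> \<subset> comp_lit ` E"
    using imageI[OF assms(2), of comp_lit] by (metis DiffD2 Diff_subset psubsetI singletonI)
  ultimately show False using min(2) by blast
qed

lemma vars_mu: "E \<in> mu \<Sigma> \<Longrightarrow> vars_clause E \<subseteq> vars_cnf \<Sigma>"
proof
  fix x assume E: "E \<in> mu \<Sigma>" and "x \<in> vars_clause E"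
  then obtain q where q: "q \<in> E" "x = var_lit q" by (auto simp: vars_clause_def)
  obtain D where "D \<in> \<Sigma>" "comp_lit q \<in> D" using mu_member_literal[OF E q(1)] by blast
  then show "x \<in> vars_cnf \<Sigma>" using q(2) vars_cnf_member in_vars_clause_iff by blast
qed

lemma finite_mu:
  assumes "is_cnf \<Sigma>"
  shows "finite (mu \<Sigma>)"
proof (rule finite_subset)
  show "mu \<Sigma> \<subseteq> Pow {l. var_lit l \<in> vars_cnf \<Sigma>}"
    using vars_mu unfolding vars_clause_def by blast
  show "finite (Pow {l. var_lit l \<in> vars_cnf \<Sigma>})"
    using finite_lits_with_vars[OF finite_vars_cnf[OF assms]] by simp
qed

lemma satisfies_imp_mu:
  assumes "is_clause E" "satisfies (comp_lit ` E) \<Sigma>"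
  shows "\<exists>E'\<in>mu \<Sigma>. E' \<subseteq> E"
proof -
  have "finite (comp_lit ` E)" using assms(1) by (simp add: is_clause_def)
  then have "\<exists>\<beta>\<subseteq>comp_lit ` E. satisfies \<beta> \<Sigma> \<and> (\<forall>\<beta>'. \<beta>' \<subset> \<beta> \<longrightarrow> \<not> satisfies \<beta>' \<Sigma>)"
    using assms(2)
  proof (induction rule: finite_psubset_induct)
    case (psubset A)
    show ?case
    proof (cases "\<exists>B. B \<subset> A \<and> satisfies B \<Sigma>")
      case True
      then obtain B where "B \<subset> A" "satisfies B \<Sigma>" by blast
      with psubset.IH[of B] show ?thesis by (meson order.trans psubset_imp_subset)
    next
      case False
      with psubset.prems show ?thesis by blast
    qed
  qed
  then obtain \<beta> where b: "\<beta> \<subseteq> comp_lit ` E" "satisfies \<beta> \<Sigma>"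
      "\<forall>\<beta>'. \<beta>' \<subset> \<beta> \<longrightarrow> \<not> satisfies \<beta>' \<Sigma>" by blast
  have sub: "comp_lit ` \<beta> \<subseteq> E" using b(1) by auto
  have "is_clause (comp_lit ` \<beta>)" using is_clause_mono[OF assms(1) sub] .
  moreover have "\<not> tautological \<beta>"
    using calculation unfolding is_clause_def tautological_iff by fastforce
  ultimately have "comp_lit ` \<beta> \<in> mu \<Sigma>"
    using b by (simp add: mu_def minimally_satisfies_def partial_assignment_def)
  with sub show ?thesis by blast
qed

text \<open>Every clause \<open>E\<close> over all variables of \<open>\<Sigma>\<close> is a
  weakening of an available one: either its negation satisfies \<open>\<Sigma>\<close> and
  \<open>E\<close> contains a member of \<open>mu \<Sigma>\<close>, or its negation misses some
  \<open>D\<close> in \<open>\<Sigma>\<close> and, \<open>E\<close> being total, \<open>D\<close>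
  lies inside \<open>E\<close>.\<close>

lemma resolution_proof_mu_exists:
  assumes "is_cnf \<Sigma>"
  shows "\<exists>\<Gamma>s. resolution_proof (\<Sigma> \<union> mu \<Sigma>) \<Gamma>s"
proof -
  let ?\<Delta> = "\<Sigma> \<union> mu \<Sigma>"
  have "derivable ?\<Delta> {}"
  proof (rule derivable_from_total_clauses[OF finite_vars_cnf[OF assms]])
    fix E assume E: "is_clause E" "vars_clause E = vars_cnf \<Sigma>"
    show "derivable ?\<Delta> E"
    proof (cases "satisfies (comp_lit ` E) \<Sigma>")
      case True
      with satisfies_imp_mu[OF E(1)] E(1) show ?thesis by (auto intro: derivable_weaken)
    next
      case False
      then obtain D where D: "D \<in> \<Sigma>" "comp_lit ` E \<inter> D = {}" by (auto simp: satisfies_def)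
      have "D \<subseteq> E"
      proof
        fix l assume l: "l \<in> D"
        then have "var_lit l \<in> vars_clause E"
          using D(1) E(2) by (auto simp: vars_cnf_def vars_clause_def)
        moreover have "comp_lit l \<notin> E"
          using D(2) l by (metis IntI comp_comp empty_iff imageI)
        ultimately show "l \<in> E" by (simp add: in_vars_clause_iff)
      qed
      with D(1) E(1) show ?thesis by (auto intro: derivable_weaken)
    qed
  qed (auto simp: is_clause_def tautological_def vars_clause_def)
  then obtain Es where Es: "clause_seq res_step ?\<Delta> Es" "{} \<in> ?\<Delta> \<union> set Es"
    unfolding derivable_def by blast
  have "is_cnf ?\<Delta>" using assms finite_mu[OF assms] by (auto simp: is_cnf_def mu_def)
  then have "derivation res_step ?\<Delta> (cnf_seq ?\<Delta> Es)"
    using Es(1) clause_seq_is_clause by (blast intro: derivation_cnf_seq)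
  then show ?thesis using Es(2) unfolding resolution_proof_def by (metis last_cnf_seq)
qed

text \<open>A nonempty infimum in \<open>enat\<close> is a least element. The given proof supplies
  nonemptiness, so the size is finite.\<close>

lemma size_Res_attained:
  assumes "resolution_proof \<Delta> \<Gamma>s0"
  shows "\<exists>\<Gamma>s. resolution_proof \<Delta> \<Gamma>s \<and> size_Res \<Delta> = enat (length \<Gamma>s)"
proof -
  let ?S = "(\<lambda>\<Gamma>s. enat (length \<Gamma>s)) ` {\<Gamma>s. resolution_proof \<Delta> \<Gamma>s}"
  have "?S \<noteq> {}" using assms by blast
  then have "Inf ?S \<in> ?S" unfolding Inf_enat_def by (metis (no_types, lifting) LeastI ex_in_conv)
  then show ?thesis unfolding size_Res_def by blast
qed

section \<open>Restricting a resolution proof and adding a side clause\<close>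

text \<open>A resolution on a variable in \<open>V\<close> stays one, because \<open>C\<close> does
  not mention that variable. If the pivot is outside \<open>V\<close>, restriction erases it and the
  image of the conclusion is a weakening of the image of the first premise. Each step becomes
  exactly one step, so length is preserved.\<close>

lemma res_step_restrict:
  assumes step: "res_step \<Delta> E"
    and C: "is_clause C" "V \<inter> vars_clause C = {}"
    and f: "\<And>A. f A = C \<union> {l \<in> A. var_lit l \<in> V}"
    and sub: "f ` \<Delta> \<subseteq> \<Delta>'"
  shows "res_step \<Delta>' (f E)"
proof -
  have clf: "is_clause (f A)" if "is_clause A" for A
    unfolding f using is_clause_Un_restrict[OF that C] .
  note clE = clf[OF res_step_is_clause[OF step]]
  from step consider
    (res) F G where "F \<in> \<Delta>" "G \<in> \<Delta>" "resolvent F G E"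
  | (weak) A B where "A \<in> \<Delta>" "E = A \<union> B"
    unfolding res_step_def weakening_def by blast
  then show ?thesis
  proof cases
    case res
    then obtain x A B where R: "is_clause F" "is_clause G" "F = A \<union> {Pos x}" "G = B \<union> {Neg x}"
        "x \<notin> vars_clause A" "x \<notin> vars_clause B" "E = A \<union> B"
      unfolding resolvent_def by blast
    have cl: "is_clause (f F)" "is_clause (f G)" using R(1,2) clf by blast+
    have mem: "f F \<in> \<Delta>'" "f G \<in> \<Delta>'" using res(1,2) sub by blast+
    show ?thesis
    proof (cases "x \<in> V")
      case True
      have eq: "f F = insert (Pos x) (f A)" "f G = insert (comp_lit (Pos x)) (f B)"
        "f E = f A \<union> f B"
        using True by (auto simp: R f)
      have "res_step \<Delta>' (f A \<union> f B)"
      proof (rule res_step_resolve[of "Pos x"])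
        show "var_lit (Pos x) \<notin> vars_clause (f A)" "var_lit (Pos x) \<notin> vars_clause (f B)"
          using True C(2) R(5,6) by (auto simp: f vars_clause_def)
      qed (use cl mem clE in \<open>simp_all only: eq\<close>)
      then show ?thesis by (simp add: eq)
    next
      case False
      then have "f F \<subseteq> f E" by (auto simp: R f)
      with mem(1) clE show ?thesis by (blast intro: res_step_weaken)
    qed
  next
    case weak
    then have "f A \<subseteq> f E" "f A \<in> \<Delta>'" using sub by (auto simp: f)
    then show ?thesis using clE by (blast intro: res_step_weaken)
  qed
qed

lemma clause_seq_restrict:
  assumes "clause_seq res_step \<Delta> Es"
    and "is_clause C" "V \<inter> vars_clause C = {}"
    and "\<And>A. f A = C \<union> {l \<in> A. var_lit l \<in> V}"
    and "f ` \<Delta> \<subseteq> \<Delta>'"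
  shows "clause_seq res_step \<Delta>' (map f Es)"
  using assms(1,5)
proof (induction Es arbitrary: \<Delta> \<Delta>')
  case (Cons E Es)
  have "res_step \<Delta>' (f E)"
    using res_step_restrict[OF _ assms(2-4), of \<Delta> E \<Delta>'] Cons.prems by simp
  moreover have "clause_seq res_step (insert (f E) \<Delta>') (map f Es)"
    using Cons.prems by (intro Cons.IH[of "insert E \<Delta>"]) auto
  ultimately show ?case by simp
qed simp

section \<open>Unit propagation trails\<close>

text \<open>A trail lists, latest first, literals forced by unit propagation when all literals of \<open>L\<close> are
  false.\<close>

inductive trail :: "'v cnf \<Rightarrow> 'v literal set \<Rightarrow> 'v literal list \<Rightarrow> bool" for \<Gamma> L where
  Nil: "trail \<Gamma> L []"
| Cons: "trail \<Gamma> L ls \<Longrightarrow> R \<in> \<Gamma> \<Longrightarrow> l \<in> R \<Longrightarrow> R - {l} \<subseteq> L \<union> comp_lit ` set ls \<Longrightarrow>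
    var_lit l \<notin> vars_clause (L \<union> comp_lit ` set ls) \<Longrightarrow> trail \<Gamma> L (l # ls)"

text \<open>The fresh variable of each new literal prevents complementary pairs among the falsified
  literals.\<close>

lemma trail_is_clause:
  "trail \<Gamma> L ls \<Longrightarrow> is_clause L \<Longrightarrow> is_clause (L \<union> comp_lit ` set ls)"
  by (induction rule: trail.induct) (auto simp: is_clause_insert in_vars_clause_iff)

text \<open>Trail literals have pairwise distinct variables and each comes from a clause of
  \<open>\<Gamma>\<close>. This is the source of the factor \<open>n\<close> in the final
  bound.\<close>

lemma trail_length_le:
  assumes "trail \<Gamma> L ls" "finite (vars_cnf \<Gamma>)"
  shows "length ls \<le> card (vars_cnf \<Gamma>)"
proof -
  have "distinct (map var_lit ls) \<and> var_lit ` set ls \<subseteq> vars_cnf \<Gamma>"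
    using assms(1)
    by (induction rule: trail.induct) (auto simp: vars_clause_def vars_cnf_def image_Un image_image)
  then have "distinct (map var_lit ls)" "var_lit ` set ls \<subseteq> vars_cnf \<Gamma>" by blast+
  then show ?thesis
    using card_mono[OF assms(2), of "var_lit ` set ls"] distinct_card[of "map var_lit ls"] by simp
qed

lemma maximal_trail_exists:
  assumes "finite (vars_cnf \<Gamma>)"
  shows "\<exists>ls. trail \<Gamma> L ls \<and> (\<forall>l. \<not> trail \<Gamma> L (l # ls))"
proof -
  have "\<exists>ls. trail \<Gamma> L ls \<and> (\<forall>ls'. trail \<Gamma> L ls' \<longrightarrow> length ls' \<le> length ls)"
  proof (rule Lattices_Big.ex_has_greatest_nat)
    show "\<forall>ls. trail \<Gamma> L ls \<longrightarrow> length ls < Suc (card (vars_cnf \<Gamma>))"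
      using trail_length_le[OF _ assms] by (simp add: less_Suc_eq_le)
  qed (rule trail.Nil)
  then show ?thesis by (metis impossible_Cons)
qed

text \<open>The invariant preserved by unit propagation under the assignment that falsifies \<open>F\<close>: a
  clause is satisfied or has at least two literals that are not falsified.\<close>

definition non_unit :: "'v literal set \<Rightarrow> 'v clause \<Rightarrow> bool" where
  "non_unit F E \<longleftrightarrow> E \<inter> comp_lit ` F \<noteq> {} \<or> (\<exists>a\<in>E - F. \<exists>b\<in>E - F. a \<noteq> b)"

lemma non_unit_mono: "non_unit F A \<Longrightarrow> A \<subseteq> E \<Longrightarrow> non_unit F E"
  unfolding non_unit_def by blast

text \<open>A single literal satisfying the invariant must be true, so its complement is false and
  contributes nothing to the invariant of the other premise. What remains must already satisfy
  it.\<close>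

lemma non_unit_resolve_unit:
  assumes "\<not> tautological F" "non_unit F {l}" "non_unit F (insert (comp_lit l) B)"
  shows "non_unit F B"
proof -
  have "comp_lit l \<in> F" using assms(2) by (auto simp: non_unit_def)
  moreover from this have "l \<notin> F" using assms(1) by (auto simp: tautological_iff)
  ultimately show ?thesis using assms(3) by (auto simp: non_unit_def)
qed

text \<open>The unit premise is essential: with both variables unassigned, the clauses {x, a} and
  {not x, a} satisfy the invariant, but their resolvent {a} does not.\<close>

lemma non_unit_step:
  assumes "unit_step \<Delta> E" "\<not> tautological F" "\<And>A. A \<in> \<Delta> \<Longrightarrow> non_unit F A"
  shows "non_unit F E"
proof -
  from assms(1) consider
    (res) G H where "G \<in> \<Delta>" "H \<in> \<Delta>" "resolvent G H E" "card G = 1 \<or> card H = 1"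
  | (weak) A where "A \<in> \<Delta>" "A \<subseteq> E"
    unfolding unit_step_def weakening_def by blast
  then show ?thesis
  proof cases
    case res
    then obtain x A B where AB: "G = A \<union> {Pos x}" "H = B \<union> {Neg x}"
        "x \<notin> vars_clause A" "x \<notin> vars_clause B" "E = A \<union> B"
      unfolding resolvent_def by blast
    then have R: "G = insert (Pos x) A" "H = insert (Neg x) B" "Pos x \<notin> A" "Neg x \<notin> B" "E = A \<union> B"
      using in_vars_clause_iff[of "Pos x"] by auto
    from res(4) show ?thesis
    proof
      assume "card G = 1"
      then have "A = {}" using R(1,3) by (auto simp: card_1_singleton_iff)
      then show ?thesis
        using non_unit_resolve_unit[OF assms(2), of "Pos x" B] assms(3) res(1,2) R by simp
    next
      assume "card H = 1"
      then have "B = {}" using R(2,4) by (auto simp: card_1_singleton_iff)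
      then show ?thesis
        using non_unit_resolve_unit[OF assms(2), of "Neg x" A] assms(3) res(1,2) R by simp
    qed
  next
    case weak
    with assms(3) show ?thesis by (blast intro: non_unit_mono)
  qed
qed

lemma non_unit_clause_seq:
  assumes "clause_seq unit_step \<Delta> Es" "\<not> tautological F" "\<And>A. A \<in> \<Delta> \<Longrightarrow> non_unit F A"
  shows "\<forall>A\<in>\<Delta> \<union> set Es. non_unit F A"
  using assms(1,3)
proof (induction Es arbitrary: \<Delta>)
  case (Cons E Es)
  have "non_unit F E" using non_unit_step[OF _ assms(2)] Cons.prems by auto
  then have "\<forall>A\<in>insert E \<Delta> \<union> set Es. non_unit F A" using Cons.prems by (intro Cons.IH) auto
  then show ?case by simp
qed simp

text \<open>Take a trail that cannot be extended and suppose it falsifies no clause of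
  \<open>\<Gamma>\<close>. A clause violating \<open>non_unit\<close> would then force a further
  literal, so all of \<open>\<Gamma>\<close> satisfies the invariant; the assumed units do too,
  being true. The invariant would pass to the empty clause, where it fails.\<close>

lemma up_implies_conflict:
  assumes "\<Gamma> \<turnstile>\<^sub>1 L'" "L' \<subseteq> L" "is_clause L" "finite (vars_cnf \<Gamma>)"
  shows "\<exists>ls. trail \<Gamma> L ls \<and> (\<exists>R\<in>\<Gamma>. R \<subseteq> L \<union> comp_lit ` set ls)"
proof -
  obtain ls where ls: "trail \<Gamma> L ls" "\<And>l. \<not> trail \<Gamma> L (l # ls)"
    using maximal_trail_exists[OF assms(4)] by blast
  let ?F = "L \<union> comp_lit ` set ls"
  have nt: "\<not> tautological ?F" using trail_is_clause[OF ls(1) assms(3)] by (simp add: is_clause_def)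
  have "\<exists>R\<in>\<Gamma>. R \<subseteq> ?F"
  proof (rule ccontr)
    assume no: "\<not> ?thesis"
    have inv: "non_unit ?F A" if "A \<in> \<Gamma> \<union> {{comp_lit q} | q. q \<in> L'}" for A
      using that
    proof
      assume A: "A \<in> \<Gamma>"
      show ?thesis
      proof (rule ccontr)
        assume neg: "\<not> non_unit ?F A"
        obtain l where l: "l \<in> A" "l \<notin> ?F" using no A by blast
        have "A - {l} \<subseteq> ?F" using neg l unfolding non_unit_def by blast
        moreover have "comp_lit l \<notin> ?F"
          using neg l(1) unfolding non_unit_def by (metis IntI comp_comp empty_iff imageI)
        then have "var_lit l \<notin> vars_clause ?F" using l(2) by (simp only: in_vars_clause_iff) simp
        ultimately show False using ls(2) trail.Cons[OF ls(1) A l(1)] by blast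
      qed
    next
      assume "A \<in> {{comp_lit q} | q. q \<in> L'}"
      then obtain q where "A = {comp_lit q}" "q \<in> L'" by blast
      with assms(2) show ?thesis by (auto simp: non_unit_def)
    qed
    obtain \<Gamma>s where \<Gamma>s: "derivation unit_step (\<Gamma> \<union> {{comp_lit q} | q. q \<in> L'}) \<Gamma>s"
        "{} \<in> last \<Gamma>s"
      using assms(1) unfolding up_implies_def unit_propagation_proof_def by blast
    obtain Es where "clause_seq unit_step (\<Gamma> \<union> {{comp_lit q} | q. q \<in> L'}) Es"
        "{} \<in> (\<Gamma> \<union> {{comp_lit q} | q. q \<in> L'}) \<union> set Es"
      using derivation_clause_seq[OF \<Gamma>s(1)] \<Gamma>s(2) by auto
    with non_unit_clause_seq[OF _ nt inv] have "non_unit ?F {}" by blast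
    then show False by (simp add: non_unit_def)
  qed
  with ls(1) show ?thesis by blast
qed

text \<open>\<open>X\<close> is the current falsified clause. From the latest literal backwards,
  \<open>X\<close> is resolved with the reason \<open>R\<close> if it contains the complement of
  \<open>l\<close>, and left alone otherwise. The pivot is never a variable of \<open>L\<close>, so
  \<open>L\<close> survives every step and is all that is left at the end.\<close>

lemma resolve_along_trail:
  assumes "trail \<Gamma> L ls" "is_clause L" "is_cnf \<Gamma>" "\<Gamma> \<subseteq> \<Delta>"
    and "X \<in> \<Delta>" "L \<subseteq> X" "X \<subseteq> L \<union> comp_lit ` set ls" "vars_clause X \<subseteq> vars_cnf \<Gamma>"
  shows "\<exists>Es. clause_seq res_step \<Delta> Es \<and> length Es \<le> length ls \<and> L \<in> \<Delta> \<union> set Es \<and>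
    (\<forall>E\<in>set Es. L \<subseteq> E \<and> vars_clause E \<subseteq> vars_cnf \<Gamma>)"
  using assms(1,4-8)
proof (induction arbitrary: \<Delta> X rule: trail.induct)
  case Nil
  then have "X = L" by auto
  with Nil show ?case by (intro exI[of _ "[]"]) auto
next
  case (Cons ls R l)
  let ?F = "L \<union> comp_lit ` set ls"
  have clF: "is_clause ?F" using trail_is_clause[OF Cons.hyps(1) assms(2)] .
  have lF: "l \<notin> ?F" "comp_lit l \<notin> ?F" using Cons.hyps(5) unfolding in_vars_clause_iff by blast+
  show ?case
  proof (cases "comp_lit l \<in> X")
    case False
    then have "X \<subseteq> ?F" using Cons.prems(4) by auto
    then obtain Es where "clause_seq res_step \<Delta> Es" "length Es \<le> length ls" "L \<in> \<Delta> \<union> set Es"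
        "\<forall>E\<in>set Es. L \<subseteq> E \<and> vars_clause E \<subseteq> vars_cnf \<Gamma>"
      using Cons.IH[OF Cons.prems(1-3) _ Cons.prems(5)] by blast
    then show ?thesis by (intro exI[of _ Es]) auto
  next
    case True
    let ?Y = "(R - {l}) \<union> (X - {comp_lit l})"
    have XF: "X - {comp_lit l} \<subseteq> ?F" using Cons.prems(4) by auto
    have YF: "?Y \<subseteq> ?F" using XF Cons.hyps(4) by blast
    have R: "insert l (R - {l}) = R" and X: "insert (comp_lit l) (X - {comp_lit l}) = X"
      using Cons.hyps(3) True by auto
    have clX: "is_clause X"
    proof (rule is_clause_mono)
      show "is_clause (insert (comp_lit l) ?F)" using clF lF by (simp add: is_clause_insert)
      show "X \<subseteq> insert (comp_lit l) ?F" using XF by blast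
    qed
    have step: "res_step \<Delta> ?Y"
    proof (rule res_step_resolve[of l])
      show "insert l (R - {l}) \<in> \<Delta>" "is_clause (insert l (R - {l}))"
        using R Cons.hyps(2) Cons.prems(1) assms(3) by (auto simp: is_cnf_def)
      show "insert (comp_lit l) (X - {comp_lit l}) \<in> \<Delta>"
        "is_clause (insert (comp_lit l) (X - {comp_lit l}))"
        using X Cons.prems(2) clX by auto
      show "is_clause ?Y" using is_clause_mono[OF clF YF] .
      show "var_lit l \<notin> vars_clause (R - {l})" "var_lit l \<notin> vars_clause (X - {comp_lit l})"
        using Cons.hyps(4,5) XF vars_clause_mono by blast+
    qed
    have LY: "L \<subseteq> ?Y" using Cons.prems(3) lF by blast
    have varsY: "vars_clause ?Y \<subseteq> vars_cnf \<Gamma>"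
      using vars_cnf_member[OF Cons.hyps(2)] Cons.prems(5) by (auto simp: vars_clause_def)
    obtain Es where "clause_seq res_step (insert ?Y \<Delta>) Es" "length Es \<le> length ls"
        "L \<in> insert ?Y \<Delta> \<union> set Es" "\<forall>E\<in>set Es. L \<subseteq> E \<and> vars_clause E \<subseteq> vars_cnf \<Gamma>"
      using Cons.IH[of "insert ?Y \<Delta>" ?Y] Cons.prems(1) LY YF varsY by auto
    then show ?thesis using step LY varsY by (intro exI[of _ "?Y # Es"]) auto
  qed
qed

text \<open>The additional step beyond the trail length is the initial weakening of the falsified
  clause \<open>R\<close> to \<open>R \<union> L\<close>, which makes every added clause contain
  \<open>L\<close>.\<close>

lemma up_implies_clause_seq:
  assumes "\<Gamma> \<turnstile>\<^sub>1 L'" "L' \<subseteq> L" "is_clause L" "is_cnf \<Gamma>" "vars_clause L \<subseteq> vars_cnf \<Gamma>"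
  shows "\<exists>Es. clause_seq res_step \<Gamma> Es \<and> length Es \<le> card (vars_cnf \<Gamma>) + 1 \<and> L \<in> \<Gamma> \<union> set Es \<and>
    (\<forall>E\<in>set Es. L \<subseteq> E \<and> vars_clause E \<subseteq> vars_cnf \<Gamma>)"
proof -
  note fin = finite_vars_cnf[OF assms(4)]
  obtain ls R where ls: "trail \<Gamma> L ls" "R \<in> \<Gamma>" "R \<subseteq> L \<union> comp_lit ` set ls"
    using up_implies_conflict[OF assms(1-3) fin] by blast
  let ?X = "R \<union> L"
  have "is_clause ?X"
    using ls(3) by (intro is_clause_mono[OF trail_is_clause[OF ls(1) assms(3)]]) blast
  then have step: "res_step \<Gamma> ?X" using ls(2) by (blast intro: res_step_weaken)
  have vars: "vars_clause ?X \<subseteq> vars_cnf \<Gamma>" using vars_cnf_member[OF ls(2)] assms(5) by simp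
  obtain Es where "clause_seq res_step (insert ?X \<Gamma>) Es" "length Es \<le> length ls"
      "L \<in> insert ?X \<Gamma> \<union> set Es" "\<forall>E\<in>set Es. L \<subseteq> E \<and> vars_clause E \<subseteq> vars_cnf \<Gamma>"
    using resolve_along_trail[OF ls(1) assms(3,4), of "insert ?X \<Gamma>" ?X] ls(3) vars
    by (auto simp: subset_insertI)
  then show ?thesis
    using step vars trail_length_le[OF ls(1) fin] by (intro exI[of _ "?X # Es"]) auto
qed

text \<open>Each piece starts from \<open>\<Gamma>\<close> alone, so by monotonicity the pieces can
  be concatenated. A subset \<open>L'\<close> is allowed because the RAT condition speaks of a set
  that may be smaller than \<open>C \<union> F\<close>.\<close>

lemma up_implies_clause_seq_all:
  assumes "finite S" "is_cnf \<Gamma>"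
    and "\<And>F. F \<in> S \<Longrightarrow> is_clause (C \<union> F) \<and> vars_clause (C \<union> F) \<subseteq> vars_cnf \<Gamma> \<and>
      (\<exists>L'\<subseteq>C \<union> F. \<Gamma> \<turnstile>\<^sub>1 L')"
  shows "\<exists>Es. clause_seq res_step \<Gamma> Es \<and> length Es \<le> card S * (card (vars_cnf \<Gamma>) + 1) \<and>
    (\<forall>F\<in>S. C \<union> F \<in> \<Gamma> \<union> set Es) \<and> (\<forall>E\<in>set Es. C \<subseteq> E \<and> vars_clause E \<subseteq> vars_cnf \<Gamma>)"
  using assms(1,3)
proof (induction S rule: finite_induct)
  case empty
  show ?case by (intro exI[of _ "[]"]) auto
next
  case (insert F S)
  then obtain Es where Es: "clause_seq res_step \<Gamma> Es"
      "length Es \<le> card S * (card (vars_cnf \<Gamma>) + 1)" "\<forall>F\<in>S. C \<union> F \<in> \<Gamma> \<union> set Es"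
      "\<forall>E\<in>set Es. C \<subseteq> E \<and> vars_clause E \<subseteq> vars_cnf \<Gamma>"
    by (metis insertI2)
  obtain L' where "\<Gamma> \<turnstile>\<^sub>1 L'" "L' \<subseteq> C \<union> F" "is_clause (C \<union> F)"
      "vars_clause (C \<union> F) \<subseteq> vars_cnf \<Gamma>"
    using insert.prems[of F] by blast
  from up_implies_clause_seq[OF this(1-3) assms(2) this(4)] obtain Es' where
    Es': "clause_seq res_step \<Gamma> Es'" "length Es' \<le> card (vars_cnf \<Gamma>) + 1"
      "C \<union> F \<in> \<Gamma> \<union> set Es'" "\<forall>E\<in>set Es'. C \<union> F \<subseteq> E \<and> vars_clause E \<subseteq> vars_cnf \<Gamma>"
    by blast
  have "clause_seq res_step \<Gamma> (Es @ Es')"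
    using Es(1) clause_seq_mono[OF Es'(1)] by (auto simp: clause_seq_append)
  moreover have "length (Es @ Es') \<le> card (insert F S) * (card (vars_cnf \<Gamma>) + 1)"
    using Es(2) Es'(2) insert.hyps by simp
  ultimately show ?case using Es(3,4) Es'(3,4) by (intro exI[of _ "Es @ Es'"]) auto
qed

section \<open>Nonblocking clauses and blocked clauses\<close>

lemma NB_memberE:
  assumes "F \<in> NB \<Gamma> p C"
  obtains D where "D \<in> \<Gamma>" "comp_lit p \<in> D" "F = D - {comp_lit p} - C"
    "\<not> tautological ((C - {p}) \<union> (D - {comp_lit p}))"
  using assms unfolding NB_def proj_def by blast

lemma is_cnf_NB: "is_cnf \<Gamma> \<Longrightarrow> is_cnf (NB \<Gamma> p C)"
proof -
  assume \<Gamma>: "is_cnf \<Gamma>"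
  have sub: "NB \<Gamma> p C \<subseteq> (\<lambda>D. D - {comp_lit p} - C) ` \<Gamma>"
    by (auto elim!: NB_memberE)
  then have "finite (NB \<Gamma> p C)" using \<Gamma> finite_surj unfolding is_cnf_def by blast
  moreover have "is_clause F" if F: "F \<in> NB \<Gamma> p C" for F
  proof -
    obtain D where "D \<in> \<Gamma>" "F = D - {comp_lit p} - C" using F by (rule NB_memberE)
    then show ?thesis using \<Gamma> unfolding is_cnf_def by (blast intro: is_clause_mono)
  qed
  ultimately show ?thesis by (auto simp: is_cnf_def)
qed

lemma vars_NB: "vars_cnf (NB \<Gamma> p C) \<subseteq> vars_cnf \<Gamma>"
  unfolding vars_cnf_def vars_clause_def by (fastforce elim!: NB_memberE)

text \<open>A literal of \<open>D - C\<close> whose variable occurs in \<open>C\<close> has its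
  complement in \<open>C\<close>. That complement is not \<open>p\<close>, so it contradicts the
  nontautology condition in \<open>NB\<close>.\<close>

lemma vars_NB_disjoint: "vars_cnf (NB \<Gamma> p C) \<inter> vars_clause C = {}"
proof -
  have "var_lit l \<notin> vars_clause C" if F: "F \<in> NB \<Gamma> p C" and l: "l \<in> F" for F l
  proof
    assume C: "var_lit l \<in> vars_clause C"
    obtain D where D: "D \<in> \<Gamma>" "comp_lit p \<in> D" "F = D - {comp_lit p} - C"
      "\<not> tautological ((C - {p}) \<union> (D - {comp_lit p}))"
      using F by (rule NB_memberE)
    have l': "l \<in> D" "l \<noteq> comp_lit p" "comp_lit l \<in> C"
      using l C D(3) by (auto simp: in_vars_clause_iff)
    then have "comp_lit l \<noteq> p" by (metis comp_comp)
    with l' D(4) show False by (auto simp: tautological_iff)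
  qed
  then have "vars_clause F \<inter> vars_clause C = {}" if "F \<in> NB \<Gamma> p C" for F
    using that unfolding vars_clause_def[of F] by blast
  then show ?thesis unfolding vars_cnf_def by blast
qed

lemma blocked_Un_mu:
  assumes "p \<in> C" "E \<in> mu (NB \<Gamma> p C)"
    and cl: "is_clause (C \<union> E)"
    and sup: "\<And>A. A \<in> \<Delta> \<Longrightarrow> A \<in> \<Gamma> \<or> is_clause A \<and> p \<in> A"
  shows "blocked \<Delta> (C \<union> E)"
proof -
  have pE: "comp_lit p \<notin> C \<union> E" using cl assms(1) by (auto simp: is_clause_def tautological_iff)
  have sat: "satisfies (comp_lit ` E) (NB \<Gamma> p C)"
    using assms(2) by (simp add: mu_def minimally_satisfies_def)
  have "blocked_for \<Delta> p (C \<union> E)"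
    unfolding blocked_for_def
  proof (intro conjI exI[of _ "C \<union> E - {p}"] allI impI)
    show "var_lit p \<notin> vars_clause (C \<union> E - {p})" using pE by (simp add: in_vars_clause_iff)
    fix D' assume D': "{comp_lit p} \<union> D' \<in> \<Delta> \<and> var_lit p \<notin> vars_clause D'"
    then have pD: "p \<notin> D'" "comp_lit p \<notin> D'" by (auto simp: in_vars_clause_iff)
    \<comment> \<open>The clauses of \<open>\<Delta>\<close> outside \<open>\<Gamma>\<close> contain
      \<open>p\<close>, whereas this one does not.\<close>
    from D' pD have "{comp_lit p} \<union> D' \<in> \<Gamma>" using sup by force
    show "tautological (C \<union> E - {p} \<union> D')"
    proof (cases "tautological ((C - {p}) \<union> D')")
      case True
      then show ?thesis by (rule tautological_mono) blast
    next
      case False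
      have "D' = ({comp_lit p} \<union> D') - {comp_lit p}" using pD by blast
      then have "D' \<in> proj (comp_lit p) \<Gamma>"
        using \<open>{comp_lit p} \<union> D' \<in> \<Gamma>\<close> unfolding proj_def by blast
      with False have "D' - C \<in> NB \<Gamma> p C" unfolding NB_def by blast
      with sat obtain q where q: "q \<in> E" "comp_lit q \<in> D' - C" unfolding satisfies_def by blast
      \<comment> \<open>If \<open>q\<close> were \<open>p\<close>, then \<open>comp_lit p\<close>
        would lie in \<open>D'\<close>. Hence \<open>q\<close> survives the removal of
        \<open>p\<close>.\<close>
      have "q \<noteq> p" using q pD by auto
      with q have "q \<in> C \<union> E - {p} \<union> D'" "comp_lit q \<in> C \<union> E - {p} \<union> D'" by auto
      then show ?thesis unfolding tautological_iff by blast
    qed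
  qed (use cl assms(1) in auto)
  then show ?thesis unfolding blocked_def using assms(1) by blast
qed

text \<open>Blockedness is assumed for every CNF whose clauses outside \<open>\<Gamma>\<close>
  contain \<open>p\<close>, since the CNF grows during the sequence; each added clause preserves
  that condition.\<close>

lemma clause_seq_blocked:
  assumes "\<And>E \<Delta>. E \<in> set Ms \<Longrightarrow> (\<And>A. A \<in> \<Delta> \<Longrightarrow> A \<in> \<Gamma> \<or> is_clause A \<and> p \<in> A) \<Longrightarrow> blocked \<Delta> E"
    and "\<And>E. E \<in> set Ms \<Longrightarrow> is_clause E \<and> p \<in> E"
    and "\<And>A. A \<in> \<Delta> \<Longrightarrow> A \<in> \<Gamma> \<or> is_clause A \<and> p \<in> A"
  shows "clause_seq blocked \<Delta> Ms"
  using assms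
proof (induction Ms arbitrary: \<Delta>)
  case (Cons E Ms)
  have "blocked \<Delta> E" by (rule Cons.prems(1)) (use Cons.prems(3) in auto)
  moreover have "clause_seq blocked (insert E \<Delta>) Ms"
  proof (rule Cons.IH)
    fix A assume "A \<in> insert E \<Delta>"
    then show "A \<in> \<Gamma> \<or> is_clause A \<and> p \<in> A" using Cons.prems(2)[of E] Cons.prems(3) by auto
  qed (use Cons.prems(1,2) in auto)
  ultimately show ?case by simp
qed simp

section \<open>Concatenating the three stages into a derivation of \<open>C\<close>\<close>

theorem theorem4p3:
  fixes \<Gamma> \<Sigma> :: "'v cnf" and C C' :: "'v clause" and p :: "'v literal" and n :: nat
  assumes "is_cnf \<Gamma>"
    and "is_clause C"
    and "C = {p} \<union> C'"
    and "var_lit p \<notin> vars_clause C'"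
    and "vars_clause C \<subseteq> vars_cnf \<Gamma>"
    and "rat_for \<Gamma> p C"
    and "\<Sigma> = NB \<Gamma> p C"
    and "n = card (vars_cnf \<Gamma>)"
  shows "\<exists>\<Gamma>s. BC_minus_derivation \<Gamma> \<Gamma>s \<and> C \<in> last \<Gamma>s \<and>
           (\<forall>D\<in>last \<Gamma>s. \<exists>D0\<in>\<Gamma> \<union> {C}. D0 \<subseteq> D) \<and>
           enat (length \<Gamma>s) \<le> enat (card \<Sigma> * (n + 1)) + s_fun \<Sigma>"
proof -
  let ?step = "\<lambda>\<Delta> E. res_step \<Delta> E \<or> blocked \<Delta> E"
  let ?V = "vars_cnf \<Sigma>"
  \<comment> \<open>A shortest refutation may introduce foreign variables by weakening. Discarding
    them avoids clashes with \<open>C\<close> and keeps all variables within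
    \<open>\<Gamma>\<close>.\<close>
  define f where "f A = C \<union> {l \<in> A. var_lit l \<in> ?V}" for A
  have p: "p \<in> C" using assms(3) by blast
  have \<Sigma>: "is_cnf \<Sigma>" "?V \<subseteq> vars_cnf \<Gamma>" "?V \<inter> vars_clause C = {}"
    unfolding assms(7)
    by (rule is_cnf_NB[OF assms(1)] vars_NB vars_NB_disjoint)+
  have f_eq: "f F = C \<union> F" if "F \<in> \<Sigma> \<union> mu \<Sigma>" for F
  proof -
    have "vars_clause F \<subseteq> ?V" using that vars_mu vars_cnf_member by blast
    then show ?thesis by (auto simp: f_def vars_clause_def)
  qed
  have vars_f: "vars_clause (f A) \<subseteq> vars_cnf \<Gamma>" for A
    using assms(5) \<Sigma>(2) by (auto simp: f_def vars_clause_def)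
  have clause_f: "is_clause (f A)" if "is_clause A" for A
    unfolding f_def using is_clause_Un_restrict[OF that assms(2) \<Sigma>(3)] .

  have rat: "\<exists>L'\<subseteq>C \<union> F. \<Gamma> \<turnstile>\<^sub>1 L'" if F: "F \<in> \<Sigma>" for F
  proof -
    obtain D where D: "D \<in> \<Gamma>" "comp_lit p \<in> D" "F = D - {comp_lit p} - C"
      using F unfolding assms(7) by (rule NB_memberE)
    let ?D = "D - {comp_lit p}"
    \<comment> \<open>\<open>rat_for\<close> comes with its own remainder \<open>C''\<close>; only
      its inclusion in \<open>C\<close> is needed below.\<close>
    obtain C'' where C'': "C = {p} \<union> C''"
      "\<And>D'. {comp_lit p} \<union> D' \<in> \<Gamma> \<Longrightarrow> var_lit p \<notin> vars_clause D' \<Longrightarrow> \<Gamma> \<turnstile>\<^sub>1 C'' \<union> D'"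
      using assms(6) unfolding rat_for_def by blast
    have "\<not> tautological D" using assms(1) D(1) by (auto simp: is_cnf_def is_clause_def)
    then have "p \<notin> D" using D(2) by (auto simp: tautological_iff)
    then have "var_lit p \<notin> vars_clause ?D" by (simp add: in_vars_clause_iff)
    moreover have "{comp_lit p} \<union> ?D = D" using D(2) by blast
    ultimately have "\<Gamma> \<turnstile>\<^sub>1 C'' \<union> ?D" using C''(2) D(1) by metis
    moreover have "C'' \<union> ?D \<subseteq> C \<union> F" using C''(1) D(3) by blast
    ultimately show ?thesis by blast
  qed
  have "\<exists>Es. clause_seq res_step \<Gamma> Es \<and> length Es \<le> card \<Sigma> * (card (vars_cnf \<Gamma>) + 1) \<and>
    (\<forall>F\<in>\<Sigma>. C \<union> F \<in> \<Gamma> \<union> set Es) \<and> (\<forall>E\<in>set Es. C \<subseteq> E \<and> vars_clause E \<subseteq> vars_cnf \<Gamma>)"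
  proof (rule up_implies_clause_seq_all[OF _ assms(1)])
    show "finite \<Sigma>" using \<Sigma>(1) by (simp add: is_cnf_def)
    fix F assume F: "F \<in> \<Sigma>"
    then show "is_clause (C \<union> F) \<and> vars_clause (C \<union> F) \<subseteq> vars_cnf \<Gamma> \<and> (\<exists>L'\<subseteq>C \<union> F. \<Gamma> \<turnstile>\<^sub>1 L')"
      using f_eq[of F] clause_f[of F] vars_f[of F] rat \<Sigma>(1) by (auto simp: is_cnf_def)
  qed
  then obtain Es where Es: "clause_seq res_step \<Gamma> Es" "length Es \<le> card \<Sigma> * (n + 1)"
      "\<forall>F\<in>\<Sigma>. C \<union> F \<in> \<Gamma> \<union> set Es" "\<forall>E\<in>set Es. C \<subseteq> E \<and> vars_clause E \<subseteq> vars_cnf \<Gamma>"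
    unfolding assms(8) by blast

  \<comment> \<open>An enumeration without repetition, so the blocked clauses cost exactly
    \<open>card (mu \<Sigma>)\<close> steps.\<close>
  obtain ms where ms: "set ms = mu \<Sigma>" "length ms = card (mu \<Sigma>)"
    using finite_mu[OF \<Sigma>(1)] finite_distinct_list distinct_card by metis
  let ?Ms = "map f ms"
  have clause_mu: "is_clause E" if "E \<in> mu \<Sigma>" for E using that by (simp add: mu_def)
  have Ms: "clause_seq blocked (\<Gamma> \<union> set Es) ?Ms"
  proof (rule clause_seq_blocked)
    fix E \<Delta>
    assume E: "E \<in> set ?Ms" and sup: "\<And>A. A \<in> \<Delta> \<Longrightarrow> A \<in> \<Gamma> \<or> is_clause A \<and> p \<in> A"
    obtain M where "M \<in> mu \<Sigma>" "E = f M" using E ms(1) by auto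
    then have M: "M \<in> mu \<Sigma>" "E = C \<union> M" "is_clause E"
      using f_eq[of M] clause_f[of M] clause_mu[of M] by auto
    show "blocked \<Delta> E"
      unfolding M(2) by (rule blocked_Un_mu[OF p _ _ sup]) (use M assms(7) in auto)
  next
    fix E assume "E \<in> set ?Ms"
    then show "is_clause E \<and> p \<in> E" using ms(1) clause_f clause_mu p by (auto simp: f_def)
  next
    fix A assume "A \<in> \<Gamma> \<union> set Es"
    then show "A \<in> \<Gamma> \<or> is_clause A \<and> p \<in> A"
      using Es(4) clause_seq_is_clause[OF Es(1)] p by blast
  qed

  obtain \<Gamma>s where \<Gamma>s: "resolution_proof (\<Sigma> \<union> mu \<Sigma>) \<Gamma>s"
      "size_Res (\<Sigma> \<union> mu \<Sigma>) = enat (length \<Gamma>s)"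
    using resolution_proof_mu_exists[OF \<Sigma>(1)] size_Res_attained by metis
  obtain Rs where Rs: "clause_seq res_step (\<Sigma> \<union> mu \<Sigma>) Rs" "length \<Gamma>s = Suc (length Rs)"
      "{} \<in> \<Sigma> \<union> mu \<Sigma> \<union> set Rs"
    using \<Gamma>s(1) derivation_clause_seq unfolding resolution_proof_def by metis
  let ?\<Delta> = "\<Gamma> \<union> set Es \<union> set ?Ms"
  have f_sub: "f ` (\<Sigma> \<union> mu \<Sigma>) \<subseteq> ?\<Delta>" using Es(3) f_eq ms(1) by auto
  have fRs: "clause_seq res_step ?\<Delta> (map f Rs)"
    by (rule clause_seq_restrict[OF Rs(1) assms(2) \<Sigma>(3) f_def f_sub])

  define Ns where "Ns = (Es @ ?Ms) @ map f Rs"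
  have seq: "clause_seq ?step \<Gamma> Ns"
    unfolding Ns_def clause_seq_append
    using Es(1) Ms fRs by (auto intro: clause_seq_impl simp: Un_assoc)
  have clauses: "is_clause E" if "E \<in> set Ns" for E
    using that clause_seq_is_clause[OF Es(1)] clause_seq_is_clause[OF fRs] clause_f clause_mu ms(1)
    unfolding Ns_def by auto
  have Ns_sup: "C \<subseteq> E \<and> vars_clause E \<subseteq> vars_cnf \<Gamma>" if "E \<in> set Ns" for E
  proof -
    from that consider "E \<in> set Es" | A where "E = f A" unfolding Ns_def by auto
    then show ?thesis
    proof cases
      case 1
      with Es(4) show ?thesis by blast
    next
      case 2
      then show ?thesis using vars_f[of A] by (simp add: f_def)
    qed
  qed
  \<comment> \<open>The empty clause at the end of the refutation is mapped to \<open>f {}\<close>,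
    which is \<open>C\<close>.\<close>
  have "f {} \<in> \<Gamma> \<union> set Ns" using Rs(3) f_sub unfolding Ns_def by auto
  then have C: "C \<in> last (cnf_seq \<Gamma> Ns)" by (simp add: last_cnf_seq f_def)
  have "vars_cnf \<Delta> \<subseteq> vars_cnf \<Gamma>" if "\<Delta> \<in> set (cnf_seq \<Gamma> Ns)" for \<Delta>
    using cnf_seq_bounds[OF that] Ns_sup unfolding vars_cnf_def by blast
  then have BC: "BC_minus_derivation \<Gamma> (cnf_seq \<Gamma> Ns)"
    unfolding BC_minus_derivation_def using derivation_cnf_seq[OF assms(1) seq clauses] by blast
  \<comment> \<open>The entry for the initial CNF \<open>\<Gamma>\<close> is absorbed by
    \<open>Suc (length Rs)\<close>: the size of the refutation also counts its initial CNF, which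
    costs no step here.\<close>
  have len: "enat (length (cnf_seq \<Gamma> Ns)) \<le> enat (card \<Sigma> * (n + 1)) + s_fun \<Sigma>"
    unfolding s_fun_def \<Gamma>s(2) using Es(2) ms(2) Rs(2) by (simp add: length_cnf_seq Ns_def)
  have "\<forall>D\<in>last (cnf_seq \<Gamma> Ns). \<exists>D0\<in>\<Gamma> \<union> {C}. D0 \<subseteq> D"
    using Ns_sup by (auto simp: last_cnf_seq)
  with BC C len show ?thesis by blast
qed

end
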